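(* Let $W=[W_{i,j}]\in\mathbb{R}^{m\times n}$, $\hat{x}\in\mathbb{R}^n$, $\hat{z}\in\mathbb{R}^m$ and $\rho>0$, and consider the one-layer problem $$L^{\star}=\min_{x\in\mathbb{R}^{n}}\ \|x-\hat{x}\|\quad\text{s.t.}\quad\|\mathrm{ReLU}(Wx)-\hat{z}\|\le\rho .$$ The SDP relaxation of this problem (written out in the context, with optimal value $L_{\mathrm{lb}}^2$) yields a tight lower bound $L_{\mathrm{lb}}=L^{\star}$ and a globally optimal $x^{\star}$ satisfying $\|x^{\star}-\hat{x}\|=L_{\mathrm{lb}}$ if one of the following two conditions holds: (i) $\rho\ge\|\mathrm{ReLU}(W\hat{x})-\hat{z}\|$; or (ii) $\rho<\dfrac{\hat{z}_{\min}}{2(1+\kappa)}$ and $\|W\hat{x}-\hat{z}\|_{\infty}<\dfrac{\hat{z}_{\min}^{2}}{2\rho\kappa}$, where $\hat{z}_{\min}=\min_{i}\hat{z}_{i}$ and $\kappa=\|W\|^{2}\,\|(WW^{T})^{-1}\|_{\infty}$.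
   Context: $\mathrm{ReLU}(x)=\max\{x,0\}$ elementwise. $\|\cdot\|$ is the Euclidean norm for vectors and the spectral norm for matrices; $\|\cdot\|_\infty$ is the max norm for vectors and the induced norm (maximum absolute row sum) for matrices. Condition (ii) presupposes that $WW^T$ is invertible. The SDP relaxation is $$L_{\mathrm{lb}}^{2}=\min_{G}\ \mathrm{tr}(X)-2\langle x,\hat{x}\rangle+\|\hat{x}\|^{2}$$ subject to $z\ge\max\{0,Wx\}$ (elementwise), $\mathrm{diag}(Z)\le\mathrm{diag}(WY)$ (elementwise), $\mathrm{tr}(Z)-2\langle z,\hat{z}\rangle+\|\hat{z}\|^{2}\le\rho^{2}$, and $$G=\begin{bmatrix} 1 & x^T & z^T \\ x & X & Y \\ z & Y^{T} & Z \end{bmatrix}\succeq0,$$ over $x\in\mathbb{R}^n$, $z\in\mathbb{R}^m$, $X\in\mathbb{R}^{n\times n}$, $Y\in\mathbb{R}^{n\times m}$, $Z\in\mathbb{R}^{m\times m}$. The relaxation is called tight if it has a unique optimal solution $G^{\star}$ and $\mathrm{rank}(G^{\star})=1$. In that case $G^\star=gg^T$ with $g=[1;x^\star;z^\star]$, and $x^\star$ is the globally optimal point referred to. "The SDP relaxation yields a tight lower bound $L_{\mathrm{lb}}=L^\star$ and a globally optimal $x^\star$ satisfying $\|x^\star-\hat x\|=L_{\mathrm{lb}}$" means that the relaxation is tight in this sense. *)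

theory Defs
  imports "HOL-Analysis.Analysis"
begin

text \<open>Vectors in $R^n$ and $R^m$ are of type \<^typ>\<open>real ^ 'n\<close> and \<^typ>\<open>real ^ 'm\<close>, so an
  $m \times n$ matrix \<open>W\<close> has type \<^typ>\<open>real ^ 'n ^ 'm\<close>. The spectral norm of \<open>W\<close> is
  \<open>onorm ((*v) W)\<close>, and the max norm of a vector is \<^const>\<open>infnorm\<close>.\<close>

definition ReLU :: "real ^ 'm \<Rightarrow> real ^ 'm" where
  "ReLU v = (\<chi> i. max (v $ i) 0)"

definition mat_infnorm :: "real ^ 'n ^ 'm \<Rightarrow> real" where
  "mat_infnorm A = Max (range (\<lambda>i. \<Sum>j\<in>UNIV. \<bar>A $ i $ j\<bar>))"

definition psd :: "real ^ 'k ^ 'k \<Rightarrow> bool" where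
  "psd A \<longleftrightarrow> transpose A = A \<and> (\<forall>v. 0 \<le> v \<bullet> (A *v v))"

definition layer_feasible :: "real ^ 'n ^ 'm \<Rightarrow> real ^ 'm \<Rightarrow> real \<Rightarrow> real ^ 'n \<Rightarrow> bool" where
  "layer_feasible W zh \<rho> x \<longleftrightarrow> norm (ReLU (W *v x) - zh) \<le> \<rho>"

definition layer_optimal ::
    "real ^ 'n ^ 'm \<Rightarrow> real ^ 'n \<Rightarrow> real ^ 'm \<Rightarrow> real \<Rightarrow> real ^ 'n \<Rightarrow> bool" where
  "layer_optimal W xh zh \<rho> x \<longleftrightarrow> is_arg_min (\<lambda>x. norm (x - xh)) (layer_feasible W zh \<rho>) x"

text \<open>The optimal values are infima. They are minima whenever the corresponding optimal
  solutions exist.\<close>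

definition L_star :: "real ^ 'n ^ 'm \<Rightarrow> real ^ 'n \<Rightarrow> real ^ 'm \<Rightarrow> real \<Rightarrow> real" where
  "L_star W xh zh \<rho> = (INF x\<in>{x. layer_feasible W zh \<rho> x}. norm (x - xh))"

text \<open>The rows and columns of \<open>G\<close> are indexed by \<^typ>\<open>unit + 'n + 'm\<close>, matching the block
  partition $1 + n + m$.\<close>

definition stack :: "real ^ 'n \<Rightarrow> real ^ 'm \<Rightarrow> real ^ (unit + 'n + 'm)" where
  "stack x z = (\<chi> a. case a of Inl _ \<Rightarrow> 1 | Inr (Inl i) \<Rightarrow> x $ i | Inr (Inr k) \<Rightarrow> z $ k)"

definition outer :: "real ^ 'k \<Rightarrow> real ^ 'k ^ 'k" where
  "outer g = (\<chi> a b. g $ a * g $ b)"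

definition block_matrix ::
    "real ^ 'n \<Rightarrow> real ^ 'm \<Rightarrow> real ^ 'n ^ 'n \<Rightarrow> real ^ 'm ^ 'n \<Rightarrow> real ^ 'm ^ 'm
      \<Rightarrow> real ^ (unit + 'n + 'm) ^ (unit + 'n + 'm)" where
  "block_matrix x z X Y Z = (\<chi> a b. case a of
      Inl _ \<Rightarrow> (case b of Inl _ \<Rightarrow> 1 | Inr (Inl j) \<Rightarrow> x $ j | Inr (Inr l) \<Rightarrow> z $ l)
    | Inr (Inl i) \<Rightarrow>
        (case b of Inl _ \<Rightarrow> x $ i | Inr (Inl j) \<Rightarrow> X $ i $ j | Inr (Inr l) \<Rightarrow> Y $ i $ l)
    | Inr (Inr k) \<Rightarrow>
        (case b of Inl _ \<Rightarrow> z $ k | Inr (Inl j) \<Rightarrow> transpose Y $ k $ j | Inr (Inr l) \<Rightarrow> Z $ k $ l))"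

definition sdp_feasible ::
    "real ^ 'n ^ 'm \<Rightarrow> real ^ 'm \<Rightarrow> real
      \<Rightarrow> real ^ 'n \<Rightarrow> real ^ 'm \<Rightarrow> real ^ 'n ^ 'n \<Rightarrow> real ^ 'm ^ 'n \<Rightarrow> real ^ 'm ^ 'm \<Rightarrow> bool" where
  "sdp_feasible W zh \<rho> x z X Y Z \<longleftrightarrow>
     (\<forall>i. max 0 ((W *v x) $ i) \<le> z $ i) \<and>
     (\<forall>i. Z $ i $ i \<le> (W ** Y) $ i $ i) \<and>
     trace Z - 2 * (z \<bullet> zh) + (norm zh)\<^sup>2 \<le> \<rho>\<^sup>2 \<and>
     psd (block_matrix x z X Y Z)"

definition sdp_objective :: "real ^ 'n \<Rightarrow> real ^ 'n \<Rightarrow> real ^ 'n ^ 'n \<Rightarrow> real" where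
  "sdp_objective xh x X = trace X - 2 * (x \<bullet> xh) + (norm xh)\<^sup>2"

definition sdp_optimal ::
    "real ^ 'n ^ 'm \<Rightarrow> real ^ 'n \<Rightarrow> real ^ 'm \<Rightarrow> real
      \<Rightarrow> real ^ (unit + 'n + 'm) ^ (unit + 'n + 'm) \<Rightarrow> bool" where
  "sdp_optimal W xh zh \<rho> G \<longleftrightarrow>
     (\<exists>x z X Y Z. G = block_matrix x z X Y Z \<and> sdp_feasible W zh \<rho> x z X Y Z \<and>
        (\<forall>x' z' X' Y' Z'. sdp_feasible W zh \<rho> x' z' X' Y' Z' \<longrightarrow>
           sdp_objective xh x X \<le> sdp_objective xh x' X'))"

text \<open>The optimal value of the relaxation is $L_{lb}^2$. It is never negative, because
  the objective dominates $\|x - \hat x\|^2$ when \<open>G\<close> is positive semidefinite.\<close>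

definition L_lb :: "real ^ 'n ^ 'm \<Rightarrow> real ^ 'n \<Rightarrow> real ^ 'm \<Rightarrow> real \<Rightarrow> real" where
  "L_lb W xh zh \<rho> =
     sqrt (Inf {sdp_objective xh x X | x z X Y Z. sdp_feasible W zh \<rho> x z X Y Z})"

definition sdp_tight :: "real ^ 'n ^ 'm \<Rightarrow> real ^ 'n \<Rightarrow> real ^ 'm \<Rightarrow> real \<Rightarrow> bool" where
  "sdp_tight W xh zh \<rho> \<longleftrightarrow>
     (\<exists>G. sdp_optimal W xh zh \<rho> G \<and> (\<forall>G'. sdp_optimal W xh zh \<rho> G' \<longrightarrow> G' = G) \<and> rank G = 1)"

definition vec_min :: "real ^ 'm \<Rightarrow> real" where
  "vec_min v = Min (range (\<lambda>i. v $ i))"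

definition kappa :: "real ^ 'n ^ 'm \<Rightarrow> real" where
  "kappa W = (onorm ((*v) W))\<^sup>2 * mat_infnorm (matrix_inv (W ** transpose W))"

end

theory Submission
  imports Defs
begin

text \<open>A positive semidefinite \<open>G\<close> is a sum of rank-one matrices \<open>g g\<^sup>T\<close> (\<open>psd_gram\<close>). Splitting each
  vector into blocks \<open>g\<^sub>k = (t\<^sub>k, p\<^sub>k, q\<^sub>k)\<close>, with \<open>\<Sum> t\<^sub>k\<^sup>2 = 1\<close>, turns the relaxation into a problem about
  finite families: the objective becomes \<open>\<Sum> \<parallel>p\<^sub>k - t\<^sub>k xh\<parallel>\<^sup>2\<close>, the ball constraint becomes
  \<open>\<Sum> \<parallel>q\<^sub>k - t\<^sub>k zh\<parallel>\<^sup>2 \<le> \<rho>\<^sup>2\<close>, and the diagonal constraint becomes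
  \<open>\<Sum> (q\<^sub>k)\<^sub>i\<^sup>2 \<le> \<Sum> (W p\<^sub>k)\<^sub>i (q\<^sub>k)\<^sub>i\<close>. The matrix \<open>G\<close> is the lift of a single point \<open>(a, b)\<close> as soon as
  \<open>p\<^sub>k = t\<^sub>k a\<close> and \<open>q\<^sub>k = t\<^sub>k b\<close> for all \<open>k\<close>. So tightness follows once every feasible family has objective at
  least \<open>\<parallel>a - xh\<parallel>\<^sup>2\<close>, with equality only for families collinear in this sense.

  If \<open>xh\<close> itself is feasible, the optimal value is 0, which forces \<open>p\<^sub>k = t\<^sub>k xh\<close>. The diagonal
  constraint then reads \<open>\<Sum> (q\<^sub>k)\<^sub>i\<^sup>2 \<le> (W xh)\<^sub>i z\<^sub>i \<le> z\<^sub>i\<^sup>2\<close>, where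
  \<open>z = \<Sum> t\<^sub>k q\<^sub>k\<close>. So the second moments of the \<open>q\<^sub>k\<close> are at most the squares of their mean \<open>z\<close>, which
  forces \<open>q\<^sub>k = t\<^sub>k z\<close>.

  Otherwise condition (ii) holds. Since \<open>\<rho>\<close> is smaller than every entry of \<open>zh\<close>, all points of the
  ball around \<open>zh\<close> are positive and the ReLU acts as the identity there. Let \<open>a\<close> be the projection
  of \<open>xh\<close> onto the convex set \<open>\<parallel>W x - zh\<parallel> \<le> \<rho>\<close>; it satisfies \<open>a - xh = - l W\<^sup>T d\<close> with
  \<open>d = W a - zh\<close>, \<open>\<parallel>d\<parallel> = \<rho>\<close> and \<open>l > 0\<close> (\<open>projection_multiplier\<close>). A dual certificate takes \<open>l\<close> for the ball
  constraint, one common multiplier \<open>2 c\<close> for all diagonal constraints, and \<open>2 (c W a + l d)\<close> for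
  \<open>z \<ge> W x\<close>. In the variables \<open>u = p - t a\<close> and \<open>v = q - t W a\<close> the Lagrangian is then a constant
  plus the quadratic form \<open>\<parallel>u\<parallel>\<^sup>2 - 2 c v \<bullet> W u + (2 c + l) \<parallel>v\<parallel>\<^sup>2\<close> (\<open>lagrangian_identity\<close>). It is
  positive definite if \<open>c\<^sup>2 \<parallel>W\<parallel>\<^sup>2 < 2 c + l\<close>, which gives both the bound and uniqueness. With
  \<open>\<delta> = \<parallel>d\<parallel>\<^sub>\<infinity>\<close> and \<open>m\<close> the least entry of \<open>zh\<close>, the multipliers of \<open>z \<ge> W x\<close> are nonnegative for
  \<open>c = l \<delta> / (m - \<delta>)\<close>, and \<open>multiplier_bound\<close> together with the two inequalities of
  condition (ii) shows that this \<open>c\<close> is small enough (\<open>penalty_parameter_bound\<close>).\<close>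

section \<open>Gram factorization of positive semidefinite matrices\<close>

lemma quadratic_form_shift:
  fixes A :: "real ^ 'k ^ 'k"
  assumes "transpose A = A"
  shows "(v + s *\<^sub>R axis i 1) \<bullet> (A *v (v + s *\<^sub>R axis i 1))
    = v \<bullet> (A *v v) + 2 * s * (A *v v) $ i + s\<^sup>2 * A $ i $ i"
proof -
  have a: "v \<bullet> (A *v axis i 1) = (A *v v) $ i"
    using assms by (metis dot_lmul_matrix vector_transpose_matrix inner_axis inner_commute mult.right_neutral
        inner_real_def real_inner_1_right)
  have b: "(A *v axis i 1) $ i = A $ i $ i"
    by (simp add: matrix_vector_mult_basis column_def)
  show ?thesis
    by (simp add: matrix_vector_right_distrib matrix_vector_mult_scaleR inner_add_left inner_add_right
        a b inner_axis' power2_eq_square algebra_simps)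
qed

text \<open>With a zero diagonal entry, the form along \<open>v + s e\<^sub>i\<close> is affine in \<open>s\<close>, so it stays
  nonnegative only if its slope \<open>2 (A v)\<^sub>i\<close> vanishes.\<close>

lemma psd_zero_diagonal_imp_zero_row:
  fixes A :: "real ^ 'k ^ 'k"
  assumes "psd A" "A $ i $ i = 0"
  shows "(A *v v) $ i = 0"
proof (rule ccontr)
  assume nz: "(A *v v) $ i \<noteq> 0"
  define s where "s = - (v \<bullet> (A *v v) + 1) / (2 * (A *v v) $ i)"
  have "0 \<le> v \<bullet> (A *v v) + 2 * s * (A *v v) $ i + s\<^sup>2 * A $ i $ i"
    using assms(1) unfolding psd_def by (metis quadratic_form_shift)
  moreover have "2 * s * (A *v v) $ i = - (v \<bullet> (A *v v) + 1)"
    using nz by (simp add: s_def)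
  ultimately show False
    using assms(2) by simp
qed

lemma outer_mult_vector: "outer g *v v = (g \<bullet> v) *\<^sub>R g"
  by (simp add: vec_eq_iff outer_def matrix_vector_mult_def inner_vec_def sum_distrib_left
      sum_distrib_right mult_ac)

text \<open>One step of Cholesky elimination. The remainder is positive semidefinite because its form
  at \<open>v\<close> is the minimum over \<open>s\<close> of the form of \<open>A\<close> at \<open>v + s e\<^sub>i\<close>. Diagonal entries that are already zero stay
  zero, so repeated steps terminate.\<close>

lemma psd_eliminate:
  fixes A :: "real ^ 'k ^ 'k"
  assumes "psd A" "A $ i $ i \<noteq> 0"
  defines "g \<equiv> (1 / sqrt (A $ i $ i)) *\<^sub>R (A $ i)"
  shows "psd (A - outer g)"
    and "(A - outer g) $ i $ i = 0"
    and "A $ j $ j = 0 \<Longrightarrow> (A - outer g) $ j $ j = 0"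
proof -
  have sym: "transpose A = A" and nn: "\<And>v. 0 \<le> v \<bullet> (A *v v)"
    using assms(1) by (auto simp: psd_def)
  have "0 \<le> axis i 1 \<bullet> (A *v axis i 1)" by (rule nn)
  then have pos: "A $ i $ i > 0"
    using assms(2) by (simp add: matrix_vector_mult_basis column_def inner_axis')
  have gg: "g $ a * g $ b = A $ i $ a * A $ i $ b / A $ i $ i" for a b
    using pos by (simp add: g_def)
  have sc: "A $ a $ b = A $ b $ a" for a b
    using sym by (metis transpose_def vec_lambda_beta)
  have row: "A $ i \<bullet> v = (A *v v) $ i" for v
    by (simp add: matrix_vector_mult_def inner_vec_def)
  have "transpose (A - outer g) = A - outer g"
    using sc by (auto simp: transpose_def vec_eq_iff outer_def)
  moreover have "0 \<le> v \<bullet> ((A - outer g) *v v)" for v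
  proof -
    \<comment> \<open>the minimizer of the form along \<open>v + s e\<^sub>i\<close>\<close>
    define s where "s = - (A *v v) $ i / A $ i $ i"
    have "0 \<le> v \<bullet> (A *v v) + 2 * s * (A *v v) $ i + s\<^sup>2 * A $ i $ i"
      using nn sym by (metis quadratic_form_shift)
    also have "\<dots> = v \<bullet> (A *v v) - ((A *v v) $ i)\<^sup>2 / A $ i $ i"
      using pos by (simp add: s_def field_simps power2_eq_square)
    also have "((A *v v) $ i)\<^sup>2 / A $ i $ i = (g \<bullet> v)\<^sup>2"
      using pos by (simp add: g_def row power_divide)
    finally show ?thesis
      by (simp add: matrix_vector_mult_diff_rdistrib outer_mult_vector inner_diff_right
          power2_eq_square inner_commute)
  qed
  ultimately show "psd (A - outer g)"
    by (simp add: psd_def)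
  show "(A - outer g) $ i $ i = 0"
    using pos by (simp add: outer_def gg)
  assume z: "A $ j $ j = 0"
  have "A $ j $ i = 0"
    using psd_zero_diagonal_imp_zero_row[OF assms(1) z, of "axis i 1"]
    by (simp add: matrix_vector_mult_basis column_def)
  then show "(A - outer g) $ j $ j = 0"
    using sc[of i j] z by (simp add: outer_def gg)
qed

lemma psd_gram:
  fixes A :: "real ^ 'k ^ 'k"
  assumes "psd A"
  obtains K :: nat and g :: "nat \<Rightarrow> real ^ 'k" where "A = (\<Sum>k<K. outer (g k))"
proof -
  have "\<exists>(K::nat) g. A = (\<Sum>k<K. outer (g k))"
    using assms
  proof (induction "card {i. A $ i $ i \<noteq> 0}" arbitrary: A rule: less_induct)
    case less
    show ?case
    proof (cases "\<exists>i. A $ i $ i \<noteq> 0")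
      case False
      then have "A *v v = 0" for v
        using psd_zero_diagonal_imp_zero_row[OF less.prems] by (simp add: vec_eq_iff)
      then have "A = 0"
        by (metis matrix_eq matrix_vector_mult_0)
      then show ?thesis by (intro exI[of _ 0]) simp
    next
      case True
      then obtain i where i: "A $ i $ i \<noteq> 0" by blast
      define h where "h = (1 / sqrt (A $ i $ i)) *\<^sub>R (A $ i)"
      note el = psd_eliminate[OF less.prems i, folded h_def]
      have "{j. (A - outer h) $ j $ j \<noteq> 0} \<subset> {j. A $ j $ j \<noteq> 0}"
        using i el(2,3) by blast
      then have "card {j. (A - outer h) $ j $ j \<noteq> 0} < card {j. A $ j $ j \<noteq> 0}"
        by (intro psubset_card_mono) auto
      from less.hyps[OF this el(1)] obtain K :: nat and g
        where g: "A - outer h = (\<Sum>k<K. outer (g k))" by blast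
      have "(\<Sum>k<K. outer ((g(K := h)) k)) = (\<Sum>k<K. outer (g k))"
        by (intro sum.cong) auto
      then have "A = (\<Sum>k<Suc K. outer ((g(K := h)) k))"
        using g by (simp add: algebra_simps)
      then show ?thesis by blast
    qed
  qed
  then show ?thesis using that by blast
qed

section \<open>The relaxation as a problem over finite families of vectors\<close>

text \<open>The block matrix of \<open>x, z, X, Y, Z\<close> is the Gram sum of the vectors \<open>(t\<^sub>k, p\<^sub>k, q\<^sub>k)\<close>, written out
  block by block so that each constraint of the relaxation can be read off separately.\<close>

definition factors ::
    "nat \<Rightarrow> (nat \<Rightarrow> real) \<Rightarrow> (nat \<Rightarrow> real ^ 'n) \<Rightarrow> (nat \<Rightarrow> real ^ 'm)
      \<Rightarrow> real ^ 'n \<Rightarrow> real ^ 'm \<Rightarrow> real ^ 'n ^ 'n \<Rightarrow> real ^ 'm ^ 'n \<Rightarrow> real ^ 'm ^ 'm \<Rightarrow> bool" where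
  "factors K t p q x z X Y Z \<longleftrightarrow>
     (\<Sum>k<K. (t k)\<^sup>2) = 1 \<and>
     (\<Sum>k<K. t k *\<^sub>R p k) = x \<and>
     (\<Sum>k<K. t k *\<^sub>R q k) = z \<and>
     (\<forall>i j. X $ i $ j = (\<Sum>k<K. p k $ i * p k $ j)) \<and>
     (\<forall>i j. Y $ i $ j = (\<Sum>k<K. p k $ i * q k $ j)) \<and>
     (\<forall>i j. Z $ i $ j = (\<Sum>k<K. q k $ i * q k $ j))"

lemma psd_block_factors:
  fixes x :: "real ^ 'n" and z :: "real ^ 'm"
  assumes "psd (block_matrix x z X Y Z)"
  obtains K t p q where "factors K t p q x z X Y Z"
proof -
  obtain K :: nat and g where g: "block_matrix x z X Y Z = (\<Sum>k<K. outer (g k))"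
    using psd_gram[OF assms] by blast
  have e: "block_matrix x z X Y Z $ a $ b = (\<Sum>k<K. g k $ a * g k $ b)" for a b
    by (simp add: g outer_def)
  define t where "t k = g k $ Inl ()" for k
  define p :: "nat \<Rightarrow> real ^ 'n" where "p k = (\<chi> i. g k $ Inr (Inl i))" for k
  define q :: "nat \<Rightarrow> real ^ 'm" where "q k = (\<chi> i. g k $ Inr (Inr i))" for k
  have "factors K t p q x z X Y Z"
    unfolding factors_def
  proof (intro conjI allI)
    show "(\<Sum>k<K. (t k)\<^sup>2) = 1"
      using e[of "Inl ()" "Inl ()"] by (simp add: block_matrix_def t_def power2_eq_square)
    show "(\<Sum>k<K. t k *\<^sub>R p k) = x"
      using e[of "Inl ()" "Inr (Inl _)"] by (simp add: block_matrix_def t_def p_def vec_eq_iff)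
    show "(\<Sum>k<K. t k *\<^sub>R q k) = z"
      using e[of "Inl ()" "Inr (Inr _)"] by (simp add: block_matrix_def t_def q_def vec_eq_iff)
    show "X $ i $ j = (\<Sum>k<K. p k $ i * p k $ j)" for i j
      using e[of "Inr (Inl i)" "Inr (Inl j)"] by (simp add: block_matrix_def p_def)
    show "Y $ i $ j = (\<Sum>k<K. p k $ i * q k $ j)" for i j
      using e[of "Inr (Inl i)" "Inr (Inr j)"] by (simp add: block_matrix_def p_def q_def)
    show "Z $ i $ j = (\<Sum>k<K. q k $ i * q k $ j)" for i j
      using e[of "Inr (Inr i)" "Inr (Inr j)"] by (simp add: block_matrix_def q_def)
  qed
  then show ?thesis using that by blast
qed

text \<open>The objective and the ball constraint have the same shape, and this identity serves both.
  Because the \<open>t\<^sub>k\<^sup>2\<close> sum to 1, the constant \<open>\<parallel>c\<parallel>\<^sup>2\<close> can be spread over the family, which completes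
  the square in every summand.\<close>

lemma trace_gram:
  fixes X :: "real ^ 'n ^ 'n"
  assumes "(\<Sum>k<K. (t k)\<^sup>2) = 1" "(\<Sum>k<K. t k *\<^sub>R p k) = x"
    and "\<And>i j. X $ i $ j = (\<Sum>k<K. p k $ i * p k $ j)"
  shows "trace X - 2 * (x \<bullet> c) + (norm c)\<^sup>2 = (\<Sum>k<(K::nat). (norm (p k - t k *\<^sub>R c))\<^sup>2)"
proof -
  have tr: "trace X = (\<Sum>k<K. p k \<bullet> p k)"
    unfolding trace_def assms(3) inner_vec_def by (subst sum.swap) simp
  have xc: "x \<bullet> c = (\<Sum>k<K. t k * (p k \<bullet> c))"
    by (simp add: assms(2)[symmetric] inner_sum_left)
  have "(norm c)\<^sup>2 = (\<Sum>k<K. (t k)\<^sup>2) * (norm c)\<^sup>2"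
    using assms(1) by simp
  then have cc: "(norm c)\<^sup>2 = (\<Sum>k<K. (t k)\<^sup>2 * (c \<bullet> c))"
    by (simp only: sum_distrib_right power2_norm_eq_inner)
  have "(norm (p k - t k *\<^sub>R c))\<^sup>2
      = p k \<bullet> p k - 2 * (t k * (p k \<bullet> c)) + (t k)\<^sup>2 * (c \<bullet> c)" for k
    unfolding power2_norm_eq_inner
    by (simp add: inner_diff_left inner_diff_right inner_commute power2_eq_square algebra_simps)
  then show ?thesis
    unfolding tr xc cc by (simp add: sum.distrib sum_subtractf sum_distrib_left)
qed

lemma sdp_objective_factors:
  assumes "factors K t p q x z X Y Z"
  shows "sdp_objective xh x X = (\<Sum>k<K. (norm (p k - t k *\<^sub>R xh))\<^sup>2)"
  unfolding sdp_objective_def using assms by (intro trace_gram) (auto simp: factors_def)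

lemma ball_constraint_factors:
  assumes "factors K t p q x z X Y Z"
  shows "trace Z - 2 * (z \<bullet> zh) + (norm zh)\<^sup>2 = (\<Sum>k<K. (norm (q k - t k *\<^sub>R zh))\<^sup>2)"
  using assms by (intro trace_gram) (auto simp: factors_def)

lemma diagonal_factors:
  fixes W :: "real ^ 'n ^ 'm"
  assumes "factors K t p q x z X Y Z"
  shows "(W ** Y) $ i $ i = (\<Sum>k<K. (W *v p k) $ i * q k $ i)"
    and "Z $ i $ i = (\<Sum>k<K. (q k $ i)\<^sup>2)"
proof -
  have "(W ** Y) $ i $ i = (\<Sum>j\<in>UNIV. \<Sum>k<K. W $ i $ j * (p k $ j * q k $ i))"
    using assms by (simp add: factors_def matrix_matrix_mult_def sum_distrib_left)
  also have "\<dots> = (\<Sum>k<K. \<Sum>j\<in>UNIV. W $ i $ j * (p k $ j * q k $ i))"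
    by (rule sum.swap)
  finally show "(W ** Y) $ i $ i = (\<Sum>k<K. (W *v p k) $ i * q k $ i)"
    by (simp add: matrix_vector_mult_def sum_distrib_right mult.assoc)
  show "Z $ i $ i = (\<Sum>k<K. (q k $ i)\<^sup>2)"
    using assms by (simp add: factors_def power2_eq_square)
qed

lemma block_matrix_rank_one:
  "block_matrix x z (\<chi> i j. x $ i * x $ j) (\<chi> i j. x $ i * z $ j) (\<chi> i j. z $ i * z $ j)
    = outer (stack x z)"
  by (auto simp: block_matrix_def outer_def stack_def vec_eq_iff transpose_def split: sum.split)

text \<open>If all vectors of the family are multiples of the single vector \<open>(1, a, b)\<close>, the weights
  \<open>t\<^sub>k\<^sup>2\<close> sum out. This is how every uniqueness claim below is obtained.\<close>

lemma collinear_factors_rank_one: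
  assumes f: "factors K t p q x z X Y Z"
    and c: "\<And>k. k < K \<Longrightarrow> p k = t k *\<^sub>R a" "\<And>k. k < K \<Longrightarrow> q k = t k *\<^sub>R b"
  shows "block_matrix x z X Y Z = outer (stack a b)"
proof -
  have t: "(\<Sum>k<K. t k * t k) = 1"
    using f by (simp add: factors_def power2_eq_square)
  have s: "(\<Sum>k<K. (t k * r) * (t k * s)) = r * s" for r s
  proof -
    have "(\<Sum>k<K. (t k * r) * (t k * s)) = (\<Sum>k<K. t k * t k) * (r * s)"
      unfolding sum_distrib_right by (intro sum.cong) auto
    then show ?thesis using t by simp
  qed
  have v: "(\<Sum>k<K. t k *\<^sub>R (t k *\<^sub>R y)) = y" for y :: "real ^ 'z"
    using t by (simp add: scaleR_sum_left[symmetric])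
  have "x = a"
    using f c(1) v[of a] by (simp add: factors_def)
  moreover have "z = b"
    using f c(2) v[of b] by (simp add: factors_def)
  moreover have "X = (\<chi> i j. a $ i * a $ j)"
    using f by (simp add: factors_def c s vec_eq_iff)
  moreover have "Y = (\<chi> i j. a $ i * b $ j)"
    using f by (simp add: factors_def c s vec_eq_iff)
  moreover have "Z = (\<chi> i j. b $ i * b $ j)"
    using f by (simp add: factors_def c s vec_eq_iff)
  ultimately show ?thesis
    using block_matrix_rank_one by blast
qed

section \<open>A criterion for tightness\<close>

lemma psd_outer: "psd (outer g)"
  by (simp add: psd_def outer_mult_vector)
     (simp add: transpose_def outer_def vec_eq_iff mult.commute inner_commute)

lemma sdp_objective_rank_one:
  "sdp_objective xh x (\<chi> i j. x $ i * x $ j) = (norm (x - xh))\<^sup>2"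
  by (simp add: sdp_objective_def trace_def power2_norm_eq_inner inner_diff_left inner_diff_right
      inner_commute algebra_simps)
     (simp add: inner_vec_def)

lemma layer_feasible_imp_sdp_feasible:
  assumes "layer_feasible W zh \<rho> x"
  defines "z \<equiv> ReLU (W *v x)"
  shows "sdp_feasible W zh \<rho> x z
    (\<chi> i j. x $ i * x $ j) (\<chi> i j. x $ i * z $ j) (\<chi> i j. z $ i * z $ j)"
  unfolding sdp_feasible_def
proof (intro conjI allI)
  show "max 0 ((W *v x) $ i) \<le> z $ i" for i
    by (simp add: z_def ReLU_def)
  show "(\<chi> i j. z $ i * z $ j) $ i $ i \<le> (W ** (\<chi> i j. x $ i * z $ j)) $ i $ i" for i
  proof -
    have "(W ** (\<chi> i j. x $ i * z $ j)) $ i $ i = (W *v x) $ i * z $ i"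
      by (simp add: matrix_matrix_mult_def matrix_vector_mult_def sum_distrib_right mult.assoc)
    then show ?thesis
      by (simp add: z_def ReLU_def max_def)
  qed
  have "(norm (z - zh))\<^sup>2 \<le> \<rho>\<^sup>2"
    using assms by (simp add: layer_feasible_def power_mono)
  then show "trace (\<chi> i j. z $ i * z $ j) - 2 * (z \<bullet> zh) + (norm zh)\<^sup>2 \<le> \<rho>\<^sup>2"
    using sdp_objective_rank_one[of zh z] by (simp add: sdp_objective_def)
  show "psd (block_matrix x z (\<chi> i j. x $ i * x $ j) (\<chi> i j. x $ i * z $ j) (\<chi> i j. z $ i * z $ j))"
    by (simp add: block_matrix_rank_one psd_outer)
qed

lemma rank_outer:
  fixes g :: "real ^ 'k"
  assumes "g \<noteq> 0"
  shows "rank (outer g) = 1"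
proof -
  have "row a (outer g) = g $ a *\<^sub>R g" for a
    by (simp add: row_def outer_def vec_eq_iff)
  then have r: "rows (outer g) = {g $ a *\<^sub>R g |a. True}"
    by (auto simp: rows_def)
  obtain a where a: "g $ a \<noteq> 0"
    using assms by (auto simp: vec_eq_iff)
  have "span (rows (outer g)) = span {g}"
  proof (rule span_eq[THEN iffD2], intro conjI subsetI)
    fix y assume "y \<in> rows (outer g)"
    then show "y \<in> span {g}"
      unfolding r by (auto intro: span_scale span_base)
  next
    fix y assume "y \<in> {g}"
    then have "y = (1 / g $ a) *\<^sub>R (g $ a *\<^sub>R g)"
      using a by simp
    moreover have "g $ a *\<^sub>R g \<in> span (rows (outer g))"
      unfolding r by (auto intro: span_base)
    ultimately show "y \<in> span (rows (outer g))"
      by (metis span_scale)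
  qed
  then have "dim (rows (outer g)) = dim {g}"
    by (metis dim_span)
  then show ?thesis
    using assms by (simp add: row_rank_def)
qed

text \<open>Points feasible for the layer problem lift to rank-one points of the relaxation with the
  same squared objective. So a lower bound valid for the whole relaxation and attained at the lift of
  \<open>a\<close> settles both problems at once.\<close>

lemma tight_if_rank_one_minimizer:
  fixes W :: "real ^ 'n ^ 'm"
  assumes feas: "layer_feasible W zh \<rho> a"
    and bound: "\<And>x z X Y Z. sdp_feasible W zh \<rho> x z X Y Z \<Longrightarrow>
      (norm (a - xh))\<^sup>2 \<le> sdp_objective xh x X"
    and unique: "\<And>x z X Y Z. sdp_feasible W zh \<rho> x z X Y Z \<Longrightarrow>
      sdp_objective xh x X \<le> (norm (a - xh))\<^sup>2 \<Longrightarrow>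
      block_matrix x z X Y Z = outer (stack a (ReLU (W *v a)))"
  shows "sdp_tight W xh zh \<rho> \<and>
         L_lb W xh zh \<rho> = L_star W xh zh \<rho> \<and>
         (\<exists>x z. sdp_optimal W xh zh \<rho> (outer (stack x z)) \<and>
                layer_optimal W xh zh \<rho> x \<and>
                norm (x - xh) = L_lb W xh zh \<rho>)"
proof -
  define b where "b = ReLU (W *v a)"
  define G where "G = outer (stack a b)"
  note fa = layer_feasible_imp_sdp_feasible[OF feas, folded b_def]
  have opt: "sdp_optimal W xh zh \<rho> G"
    unfolding sdp_optimal_def G_def block_matrix_rank_one[symmetric]
    by (intro exI conjI allI impI, rule refl, rule fa)
       (simp add: sdp_objective_rank_one bound)
  have uniq: "G' = G" if "sdp_optimal W xh zh \<rho> G'" for G'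
    using that fa unique unfolding sdp_optimal_def G_def b_def
    by (metis sdp_objective_rank_one)
  have "stack a b \<noteq> 0"
    by (auto simp: vec_eq_iff stack_def intro!: exI[of _ "Inl ()"])
  then have tight: "sdp_tight W xh zh \<rho>"
    unfolding sdp_tight_def using opt uniq rank_outer G_def by blast
  have "Inf {sdp_objective xh x X | x z X Y Z. sdp_feasible W zh \<rho> x z X Y Z} = (norm (a - xh))\<^sup>2"
  proof (rule cInf_eq_minimum)
    show "(norm (a - xh))\<^sup>2 \<in> {sdp_objective xh x X | x z X Y Z. sdp_feasible W zh \<rho> x z X Y Z}"
      using fa sdp_objective_rank_one[of xh a] by (smt (verit, best) mem_Collect_eq)
  qed (use bound in auto)
  then have lb: "L_lb W xh zh \<rho> = norm (a - xh)"
    by (simp add: L_lb_def)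
  have min: "norm (a - xh) \<le> norm (x - xh)" if "layer_feasible W zh \<rho> x" for x
    using bound[OF layer_feasible_imp_sdp_feasible[OF that]]
    by (simp add: sdp_objective_rank_one)
  have "L_star W xh zh \<rho> = norm (a - xh)"
    unfolding L_star_def by (rule cInf_eq_minimum) (use feas min in auto)
  moreover have "layer_optimal W xh zh \<rho> a"
    using feas min by (auto simp: layer_optimal_def is_arg_min_linorder)
  ultimately show ?thesis
    using tight lb opt G_def by auto
qed

section \<open>The data point is feasible\<close>

text \<open>A vanishing sum of squares gives \<open>p\<^sub>k = t\<^sub>k xh\<close>. The sum of the \<open>((q\<^sub>k)\<^sub>i - t\<^sub>k z\<^sub>i)\<^sup>2\<close> then acts as a
  variance: it equals \<open>\<Sum> (q\<^sub>k)\<^sub>i\<^sup>2 - z\<^sub>i\<^sup>2\<close>, and the constraints bound the second moment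
  \<open>\<Sum> (q\<^sub>k)\<^sub>i\<^sup>2\<close> by \<open>(W xh)\<^sub>i z\<^sub>i \<le> z\<^sub>i\<^sup>2\<close>, so it is zero. The resulting equality
  \<open>z\<^sub>i\<^sup>2 = (W xh)\<^sub>i z\<^sub>i\<close>, with \<open>z\<^sub>i \<ge> 0\<close> and \<open>z\<^sub>i \<ge> (W xh)\<^sub>i\<close>, leaves only the ReLU value.\<close>

lemma objective_zero_imp_rank_one:
  fixes W :: "real ^ 'n ^ 'm"
  assumes feas: "sdp_feasible W zh \<rho> x z X Y Z" and zero: "sdp_objective xh x X \<le> 0"
  shows "block_matrix x z X Y Z = outer (stack xh (ReLU (W *v xh)))"
proof -
  obtain K t p q where f: "factors K t p q x z X Y Z"
    using feas psd_block_factors unfolding sdp_feasible_def by metis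
  have t: "(\<Sum>k<K. (t k)\<^sup>2) = 1" and x: "(\<Sum>k<K. t k *\<^sub>R p k) = x"
    and z: "(\<Sum>k<K. t k *\<^sub>R q k) = z"
    using f by (auto simp: factors_def)
  have "(\<Sum>k<K. (norm (p k - t k *\<^sub>R xh))\<^sup>2) = 0"
    using zero sdp_objective_factors[OF f, of xh] by (smt (verit) sum_nonneg zero_le_power2)
  then have p: "p k = t k *\<^sub>R xh" if "k < K" for k
    using that by (subst (asm) sum_nonneg_eq_0_iff) auto
  have "x = (\<Sum>k<K. (t k)\<^sup>2) *\<^sub>R xh"
    unfolding x[symmetric] scaleR_sum_left by (intro sum.cong) (auto simp: p power2_eq_square)
  then have xxh: "x = xh" using t by simp
  have zi: "z $ i = (\<Sum>k<K. t k * q k $ i)" for i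
    using z by auto
  have zz: "(\<Sum>k<K. (q k $ i - t k * z $ i)\<^sup>2) \<le> 0 \<and> z $ i = ReLU (W *v xh) $ i" for i
  proof -
    let ?w = "(W *v xh) $ i"
    have "(\<Sum>k<K. (W *v p k) $ i * q k $ i) = (\<Sum>k<K. ?w * (t k * q k $ i))"
      by (intro sum.cong) (auto simp: p matrix_vector_mult_scaleR)
    also have "\<dots> = ?w * z $ i"
      by (simp add: zi sum_distrib_left)
    finally have le: "(\<Sum>k<K. (q k $ i)\<^sup>2) \<le> ?w * z $ i"
      using feas diagonal_factors[OF f] unfolding sdp_feasible_def by metis
    have ge: "0 \<le> z $ i" "?w \<le> z $ i"
      using feas xxh unfolding sdp_feasible_def by (metis max.bounded_iff)+
    \<comment> \<open>variance equals second moment minus squared mean\<close>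
    have "(\<Sum>k<K. (q k $ i - t k * z $ i)\<^sup>2)
        = (\<Sum>k<K. (q k $ i)\<^sup>2) - 2 * z $ i * (\<Sum>k<K. t k * q k $ i) + (z $ i)\<^sup>2 * (\<Sum>k<K. (t k)\<^sup>2)"
      unfolding sum_distrib_left sum_subtractf[symmetric] sum.distrib[symmetric]
      by (intro sum.cong) (auto simp: power2_eq_square algebra_simps)
    also have "\<dots> = (\<Sum>k<K. (q k $ i)\<^sup>2) - (z $ i)\<^sup>2"
      using t zi by (simp add: power2_eq_square)
    finally have eq: "(\<Sum>k<K. (q k $ i - t k * z $ i)\<^sup>2) = (\<Sum>k<K. (q k $ i)\<^sup>2) - (z $ i)\<^sup>2" .
    have "?w * z $ i \<le> (z $ i)\<^sup>2"
      using ge by (simp add: power2_eq_square mult_right_mono)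
    then have 1: "(\<Sum>k<K. (q k $ i - t k * z $ i)\<^sup>2) \<le> 0"
      using eq le by linarith
    have "0 \<le> (\<Sum>k<K. (q k $ i - t k * z $ i)\<^sup>2)"
      by (intro sum_nonneg) auto
    then have "(z $ i)\<^sup>2 \<le> ?w * z $ i"
      using eq le by linarith
    then have "z $ i = 0 \<or> z $ i \<le> ?w"
      using ge by (auto simp: power2_eq_square mult_le_cancel_right)
    then show ?thesis
      using 1 ge by (auto simp: ReLU_def)
  qed
  have "q k $ i = t k * z $ i" if "k < K" for k i
  proof -
    have "(\<Sum>k<K. (q k $ i - t k * z $ i)\<^sup>2) = 0"
      using zz[of i] by (meson antisym sum_nonneg zero_le_power2)
    then show ?thesis
      using that by (subst (asm) sum_nonneg_eq_0_iff) auto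
  qed
  then have "q k = t k *\<^sub>R z" if "k < K" for k
    using that by (simp add: vec_eq_iff)
  moreover have "z = ReLU (W *v xh)"
    using zz by (simp add: vec_eq_iff)
  ultimately show ?thesis
    using collinear_factors_rank_one[OF f p] by blast
qed

lemma tight_if_data_feasible:
  fixes W :: "real ^ 'n ^ 'm"
  assumes "norm (ReLU (W *v xh) - zh) \<le> \<rho>"
  shows "sdp_tight W xh zh \<rho> \<and>
         L_lb W xh zh \<rho> = L_star W xh zh \<rho> \<and>
         (\<exists>x z. sdp_optimal W xh zh \<rho> (outer (stack x z)) \<and>
                layer_optimal W xh zh \<rho> x \<and>
                norm (x - xh) = L_lb W xh zh \<rho>)"
proof (rule tight_if_rank_one_minimizer)
  show "layer_feasible W zh \<rho> xh"
    using assms by (simp add: layer_feasible_def)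
  fix x z X Y Z assume feas: "sdp_feasible W zh \<rho> x z X Y Z"
  then obtain K t p q where f: "factors K t p q x z X Y Z"
    using psd_block_factors unfolding sdp_feasible_def by metis
  show "(norm (xh - xh))\<^sup>2 \<le> sdp_objective xh x X"
    by (simp add: sdp_objective_factors[OF f] sum_nonneg)
  assume "sdp_objective xh x X \<le> (norm (xh - xh))\<^sup>2"
  then show "block_matrix x z X Y Z = outer (stack xh (ReLU (W *v xh)))"
    using objective_zero_imp_rank_one[OF feas] by simp
qed

section \<open>A dual certificate\<close>

lemma binary_form_pos:
  fixes r s w c e :: real
  assumes "c\<^sup>2 * w\<^sup>2 < e" "r \<noteq> 0 \<or> s \<noteq> 0"
  shows "0 < r\<^sup>2 - 2 * c * w * r * s + e * s\<^sup>2"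
proof (cases "s = 0")
  case False
  have "r\<^sup>2 - 2 * c * w * r * s + e * s\<^sup>2 = (r - c * w * s)\<^sup>2 + (e - c\<^sup>2 * w\<^sup>2) * s\<^sup>2"
    by (simp add: power2_eq_square algebra_simps)
  also have "\<dots> > 0"
    using assms(1) False by (intro add_nonneg_pos) auto
  finally show ?thesis .
qed (use assms in auto)

lemma matrix_form_pos:
  fixes W :: "real ^ 'n ^ 'm"
  assumes "0 \<le> c" "c\<^sup>2 * (onorm ((*v) W))\<^sup>2 < e" "u \<noteq> 0 \<or> v \<noteq> 0"
  shows "0 < (norm u)\<^sup>2 - 2 * c * (v \<bullet> (W *v u)) + e * (norm v)\<^sup>2"
proof -
  have "v \<bullet> (W *v u) \<le> norm v * norm (W *v u)"
    by (rule norm_cauchy_schwarz)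
  also have "\<dots> \<le> norm v * (onorm ((*v) W) * norm u)"
    by (intro mult_left_mono onorm) auto
  finally have "2 * c * (v \<bullet> (W *v u)) \<le> 2 * c * (norm v * (onorm ((*v) W) * norm u))"
    using assms(1) by (simp add: mult_left_mono)
  moreover have "0 < (norm u)\<^sup>2 - 2 * c * onorm ((*v) W) * norm u * norm v + e * (norm v)\<^sup>2"
    using assms(2,3) by (intro binary_form_pos) auto
  ultimately show ?thesis
    by (simp add: mult_ac)
qed

text \<open>The left-hand side is the contribution of one vector \<open>(t, p, q)\<close> to the Lagrangian of the
  relaxation. By stationarity, all terms linear in \<open>p - t a\<close> or \<open>q - t W a\<close> cancel, and what remains is the
  optimal value and a pure quadratic form in these two differences.\<close>

lemma lagrangian_identity:
  fixes W :: "real ^ 'n ^ 'm" and a xh :: "real ^ 'n" and zh :: "real ^ 'm"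
  defines "d \<equiv> W *v a - zh"
  assumes stat: "a - xh = - (l *\<^sub>R (transpose W *v d))"
  shows "(norm (p - t *\<^sub>R xh))\<^sup>2 + 2 * t * ((c *\<^sub>R (W *v a) + l *\<^sub>R d) \<bullet> (W *v p - q))
      + 2 * c * (q \<bullet> q - q \<bullet> (W *v p)) + l * ((norm (q - t *\<^sub>R zh))\<^sup>2 - t\<^sup>2 * (norm d)\<^sup>2)
    = t\<^sup>2 * (norm (a - xh))\<^sup>2
      + ((norm (p - t *\<^sub>R a))\<^sup>2 - 2 * c * ((q - t *\<^sub>R (W *v a)) \<bullet> (W *v (p - t *\<^sub>R a)))
         + (2 * c + l) * (norm (q - t *\<^sub>R (W *v a)))\<^sup>2)"
proof -
  define u where "u = p - t *\<^sub>R a"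
  define v where "v = q - t *\<^sub>R (W *v a)"
  define b where "b = W *v a"
  define e where "e = a - xh"
  have p: "p - t *\<^sub>R xh = u + t *\<^sub>R e"
    by (simp add: u_def e_def algebra_simps)
  have q: "q - t *\<^sub>R zh = v + t *\<^sub>R d" "q = v + t *\<^sub>R b"
    by (simp_all add: v_def d_def b_def algebra_simps)
  have Wp: "W *v p = W *v u + t *\<^sub>R b"
    by (simp add: u_def b_def matrix_vector_mult_diff_distrib matrix_vector_mult_scaleR)
  have ue: "u \<bullet> e = - l * (d \<bullet> (W *v u))"
  proof -
    have "(transpose W *v d) \<bullet> u = d \<bullet> (W *v u)"
      by (metis dot_lmul_matrix vector_transpose_matrix transpose_transpose)
    then show ?thesis
      unfolding e_def stat by (simp add: inner_commute)
  qed
  have "(norm (u + t *\<^sub>R e))\<^sup>2 = (norm u)\<^sup>2 - 2 * t * l * (d \<bullet> (W *v u)) + t\<^sup>2 * (norm e)\<^sup>2"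
  proof -
    have "(norm (u + t *\<^sub>R e))\<^sup>2 = (norm u)\<^sup>2 + 2 * t * (u \<bullet> e) + t\<^sup>2 * (norm e)\<^sup>2"
      unfolding power2_norm_eq_inner
      by (simp add: inner_add_left inner_add_right inner_commute power2_eq_square algebra_simps)
    then show ?thesis by (simp add: ue)
  qed
  moreover have "(norm (v + t *\<^sub>R d))\<^sup>2 = (norm v)\<^sup>2 + 2 * t * (d \<bullet> v) + t\<^sup>2 * (norm d)\<^sup>2"
    unfolding power2_norm_eq_inner
    by (simp add: inner_add_left inner_add_right inner_commute power2_eq_square algebra_simps)
  moreover have "v \<bullet> v = (norm v)\<^sup>2"
    by (simp add: power2_norm_eq_inner)
  ultimately show ?thesis
    unfolding p q(1) u_def[symmetric] v_def[symmetric] b_def[symmetric] e_def[symmetric] Wp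
    unfolding q(2)
    by (simp add: inner_add_left inner_add_right inner_diff_left inner_diff_right inner_commute power2_eq_square algebra_simps)
qed

text \<open>Weak duality: each constraint contributes a nonpositive term to the summed Lagrangian
  identity, so the objective exceeds \<open>\<parallel>a - xh\<parallel>\<^sup>2\<close> by at least the sum of the quadratic forms. As these are
  positive definite, equality makes every difference zero and the family collinear.\<close>

lemma tight_if_dual_certificate:
  fixes W :: "real ^ 'n ^ 'm" and a xh :: "real ^ 'n" and zh :: "real ^ 'm"
  defines "d \<equiv> W *v a - zh"
  assumes stat: "a - xh = - (l *\<^sub>R (transpose W *v d))"
    and norm_d: "norm d = \<rho>"
    and active: "\<And>i. 0 \<le> (W *v a) $ i"
    and l: "0 \<le> l" and c: "0 \<le> c"
    and mult: "\<And>i. 0 \<le> c * (W *v a) $ i + l * d $ i"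
    and pd: "c\<^sup>2 * (onorm ((*v) W))\<^sup>2 < 2 * c + l"
  shows "sdp_tight W xh zh \<rho> \<and>
         L_lb W xh zh \<rho> = L_star W xh zh \<rho> \<and>
         (\<exists>x z. sdp_optimal W xh zh \<rho> (outer (stack x z)) \<and>
                layer_optimal W xh zh \<rho> x \<and>
                norm (x - xh) = L_lb W xh zh \<rho>)"
proof -
  have relu: "ReLU (W *v a) = W *v a"
    using active by (simp add: ReLU_def vec_eq_iff max_absorb1)
  define gap where "gap t p q = (norm (p - t *\<^sub>R a))\<^sup>2
      - 2 * c * ((q - t *\<^sub>R (W *v a)) \<bullet> (W *v (p - t *\<^sub>R a)))
      + (2 * c + l) * (norm (q - t *\<^sub>R (W *v a)))\<^sup>2" for t p q
  have gap_nonneg: "0 \<le> gap t p q" for t p q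
    using matrix_form_pos[OF c pd, of "p - t *\<^sub>R a" "q - t *\<^sub>R (W *v a)"]
    unfolding gap_def by force
  have gap_zero: "p = t *\<^sub>R a \<and> q = t *\<^sub>R (W *v a)" if "gap t p q = 0" for t p q
    using matrix_form_pos[OF c pd, of "p - t *\<^sub>R a" "q - t *\<^sub>R (W *v a)"] that
    unfolding gap_def by force
  have bound: "(norm (a - xh))\<^sup>2 + (\<Sum>k<K. gap (t k) (p k) (q k)) \<le> sdp_objective xh x X"
    if feas: "sdp_feasible W zh \<rho> x z X Y Z" and f: "factors K t p q x z X Y Z"
    for x z X Y Z K t p q
  proof -
    have t: "(\<Sum>k<K. (t k)\<^sup>2) = 1" and x: "(\<Sum>k<K. t k *\<^sub>R p k) = x"
      and z: "(\<Sum>k<K. t k *\<^sub>R q k) = z"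
      using f by (auto simp: factors_def)
    define y where "y = c *\<^sub>R (W *v a) + l *\<^sub>R d"
    have "W *v x - z = (\<Sum>k<K. t k *\<^sub>R (W *v p k - q k))"
      unfolding x[symmetric] z[symmetric]
      by (simp add: linear_sum[OF matrix_vector_mul_linear] matrix_vector_mult_scaleR
          scaleR_diff_right sum_subtractf)
    then have "(\<Sum>k<K. t k * (y \<bullet> (W *v p k - q k))) = y \<bullet> (W *v x - z)"
      by (simp add: inner_sum_right)
    also have "\<dots> \<le> 0"
      unfolding inner_vec_def
    proof (rule sum_nonpos)
      fix i
      have "(W *v x) $ i \<le> z $ i"
        using feas unfolding sdp_feasible_def by (metis max.bounded_iff)
      then show "y $ i \<bullet> (W *v x - z) $ i \<le> 0"
        using mult[of i] by (simp add: y_def mult_nonneg_nonpos)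
    qed
    finally have 1: "(\<Sum>k<K. t k * (y \<bullet> (W *v p k - q k))) \<le> 0" .
    have "(\<Sum>k<K. q k \<bullet> q k - q k \<bullet> (W *v p k)) = (\<Sum>i\<in>UNIV. Z $ i $ i - (W ** Y) $ i $ i)"
      unfolding diagonal_factors[OF f] inner_vec_def sum_subtractf[symmetric]
      by (subst sum.swap) (simp add: power2_eq_square mult.commute)
    also have "\<dots> \<le> 0"
      using feas by (intro sum_nonpos) (simp add: sdp_feasible_def)
    finally have 2: "c * (\<Sum>k<K. q k \<bullet> q k - q k \<bullet> (W *v p k)) \<le> 0"
      using c by (simp add: mult_nonneg_nonpos)
    have "(\<Sum>k<K. (norm (q k - t k *\<^sub>R zh))\<^sup>2) \<le> \<rho>\<^sup>2"
      using feas ball_constraint_factors[OF f, of zh] by (simp add: sdp_feasible_def)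
    moreover have "(\<Sum>k<K. (norm (q k - t k *\<^sub>R zh))\<^sup>2 - (t k)\<^sup>2 * (norm d)\<^sup>2)
        = (\<Sum>k<K. (norm (q k - t k *\<^sub>R zh))\<^sup>2) - \<rho>\<^sup>2"
      using t norm_d by (simp add: sum_subtractf sum_distrib_right[symmetric])
    ultimately have 3: "l * (\<Sum>k<K. (norm (q k - t k *\<^sub>R zh))\<^sup>2 - (t k)\<^sup>2 * (norm d)\<^sup>2) \<le> 0"
      using l by (simp add: mult_nonneg_nonpos)
    have "(norm (a - xh))\<^sup>2 + (\<Sum>k<K. gap (t k) (p k) (q k))
        = (\<Sum>k<K. (t k)\<^sup>2) * (norm (a - xh))\<^sup>2 + (\<Sum>k<K. gap (t k) (p k) (q k))"
      using t by simp
    also have "\<dots> = (\<Sum>k<K. (t k)\<^sup>2 * (norm (a - xh))\<^sup>2 + gap (t k) (p k) (q k))"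
      by (simp add: sum_distrib_right sum.distrib)
    also have "\<dots> = (\<Sum>k<K. (norm (p k - t k *\<^sub>R xh))\<^sup>2 + 2 * t k * (y \<bullet> (W *v p k - q k))
        + 2 * c * (q k \<bullet> q k - q k \<bullet> (W *v p k))
        + l * ((norm (q k - t k *\<^sub>R zh))\<^sup>2 - (t k)\<^sup>2 * (norm d)\<^sup>2))"
      unfolding gap_def y_def d_def
      using stat[unfolded d_def] by (intro sum.cong refl lagrangian_identity[symmetric])
    also have "\<dots> = sdp_objective xh x X + 2 * (\<Sum>k<K. t k * (y \<bullet> (W *v p k - q k)))
        + 2 * (c * (\<Sum>k<K. q k \<bullet> q k - q k \<bullet> (W *v p k)))
        + l * (\<Sum>k<K. (norm (q k - t k *\<^sub>R zh))\<^sup>2 - (t k)\<^sup>2 * (norm d)\<^sup>2)"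
      unfolding sdp_objective_factors[OF f] sum.distrib sum_distrib_left by (simp add: mult_ac)
    finally show ?thesis
      using 1 2 3 by linarith
  qed
  show ?thesis
  proof (rule tight_if_rank_one_minimizer)
    show "layer_feasible W zh \<rho> a"
      using norm_d by (simp add: layer_feasible_def relu d_def)
    fix x z X Y Z assume feas: "sdp_feasible W zh \<rho> x z X Y Z"
    then obtain K t p q where f: "factors K t p q x z X Y Z"
      using psd_block_factors unfolding sdp_feasible_def by metis
    have nn: "0 \<le> (\<Sum>k<K. gap (t k) (p k) (q k))"
      by (intro sum_nonneg gap_nonneg)
    then show "(norm (a - xh))\<^sup>2 \<le> sdp_objective xh x X"
      using bound[OF feas f] by linarith
    assume "sdp_objective xh x X \<le> (norm (a - xh))\<^sup>2"
    then have "(\<Sum>k<K. gap (t k) (p k) (q k)) = 0"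
      using bound[OF feas f] nn by linarith
    then have "gap (t k) (p k) (q k) = 0" if "k < K" for k
      using that gap_nonneg by (subst (asm) sum_nonneg_eq_0_iff) auto
    then show "block_matrix x z X Y Z = outer (stack a (ReLU (W *v a)))"
      unfolding relu using gap_zero by (intro collinear_factors_rank_one[OF f]) blast+
  qed
qed

section \<open>The projection onto the linearized feasible set\<close>

text \<open>Farkas' lemma for a single inequality. A perturbation by a small multiple of \<open>- a\<close> extends
  the hypothesis to \<open>a \<bullet> v \<le> 0\<close>; it is then tested on the negated component of \<open>c\<close> orthogonal to \<open>a\<close>,
  which must vanish.\<close>

lemma antiparallel_if_halfspace:
  fixes a c :: "'a :: real_inner"
  assumes "a \<noteq> 0" and h: "\<And>v. a \<bullet> v < 0 \<Longrightarrow> 0 \<le> c \<bullet> v"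
  obtains l where "0 \<le> l" "c = - (l *\<^sub>R a)"
proof -
  have h': "0 \<le> c \<bullet> v" if "a \<bullet> v \<le> 0" for v
  proof (rule field_le_epsilon)
    fix \<epsilon> :: real assume "\<epsilon> > 0"
    define s where "s = \<epsilon> / (\<bar>c \<bullet> a\<bar> + 1)"
    have s: "s > 0" using \<open>\<epsilon> > 0\<close> by (simp add: s_def add_nonneg_pos)
    have "a \<bullet> (v - s *\<^sub>R a) < 0"
      using that s assms(1) by (simp add: inner_diff_right add_pos_nonneg)
        (smt (verit) inner_gt_zero_iff mult_pos_pos)
    then have "0 \<le> c \<bullet> v - s * (c \<bullet> a)"
      using h by (fastforce simp: inner_diff_right)
    moreover have "\<bar>s * (c \<bullet> a)\<bar> \<le> s * (\<bar>c \<bullet> a\<bar> + 1)"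
      using s by (simp add: abs_mult)
    moreover have "s * (\<bar>c \<bullet> a\<bar> + 1) = \<epsilon>"
      by (simp add: s_def add_nonneg_pos field_simps)
    ultimately show "0 \<le> c \<bullet> v + \<epsilon>" by linarith
  qed
  define r where "r = (c \<bullet> a) / (a \<bullet> a)"
  have aa: "a \<bullet> a > 0" using assms(1) by simp
  define v where "v = r *\<^sub>R a - c"
  have av: "a \<bullet> v = 0"
    using aa by (simp add: v_def r_def inner_diff_right inner_commute)
  have "0 \<le> c \<bullet> v" using h' av by simp
  also have "c \<bullet> v = (r *\<^sub>R a - v) \<bullet> v" by (simp add: v_def)
  also have "\<dots> = - (v \<bullet> v)" using av by (simp add: inner_diff_left)
  finally have "v = 0"
    by (metis inner_eq_zero_iff inner_ge_zero neg_0_le_iff_le order_antisym)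
  then have "c = - ((- r) *\<^sub>R a)" by (simp add: v_def)
  moreover have "0 \<le> c \<bullet> (- a)"
    using h'[of "- a"] aa by simp
  then have "0 \<le> - r"
    using aa by (simp add: r_def divide_nonpos_pos)
  ultimately show ?thesis using that by blast
qed

lemma matrix_inv_inverse:
  fixes A :: "real ^ 'n ^ 'm"
  assumes "invertible A"
  shows "A ** matrix_inv A = mat 1" "matrix_inv A ** A = mat 1"
  using someI_ex[OF assms[unfolded invertible_def]] by (auto simp: matrix_inv_def)

text \<open>The Karush-Kuhn-Tucker conditions for the projection of \<open>xh\<close> onto \<open>{x. \<parallel>W x - zh\<parallel> \<le> \<rho>}\<close>.
  From the projection, every feasible direction makes an obtuse or right angle with \<open>xh - a\<close>. If
  the constraint were inactive, the direction \<open>xh - a\<close> itself would be feasible. When it is active,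
  all directions \<open>v\<close> with \<open>W\<^sup>T d \<bullet> v < 0\<close> are feasible, and the one-inequality Farkas lemma yields the
  multiplier. Invertibility of \<open>W W\<^sup>T\<close> makes the set nonempty and \<open>W\<^sup>T d\<close> nonzero.\<close>

lemma projection_multiplier:
  fixes W :: "real ^ 'n ^ 'm" and xh :: "real ^ 'n" and zh :: "real ^ 'm"
  assumes inv: "invertible (W ** transpose W)" and "\<rho> > 0"
    and out: "norm (W *v xh - zh) > \<rho>"
  obtains a l where "0 < l" "norm (W *v a - zh) = \<rho>"
    "a - xh = - (l *\<^sub>R (transpose W *v (W *v a - zh)))"
proof -
  define S where "S = {x. norm (W *v x - zh) \<le> \<rho>}"
  have S: "S = (*v) W -` cball zh \<rho>"
    by (auto simp: S_def dist_norm norm_minus_commute)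
  have "convex S"
    unfolding S by (intro convex_linear_vimage) auto
  moreover have "closed S"
    unfolding S by (intro closed_vimage continuous_intros)
      (auto intro: linear_continuous_on simp: linear_linear)
  ultimately have proj: "(xh - closest_point S xh) \<bullet> (x - closest_point S xh) \<le> 0"
    if "x \<in> S" for x
    using that by (rule closest_point_dot)
  have "W *v (transpose W *v (matrix_inv (W ** transpose W) *v zh)) = zh"
    by (simp add: matrix_vector_mul_assoc matrix_mul_assoc matrix_inv_inverse[OF inv])
  then have "transpose W *v (matrix_inv (W ** transpose W) *v zh) \<in> S"
    using \<open>\<rho> > 0\<close> by (simp add: S_def)
  then have "S \<noteq> {}" by blast
  define a where "a = closest_point S xh"
  have aS: "a \<in> S"
    using \<open>closed S\<close> \<open>S \<noteq> {}\<close> by (simp add: a_def closest_point_in_set)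
  define d where "d = W *v a - zh"
  have d: "norm d \<le> \<rho>" using aS by (simp add: S_def d_def)
  have neq: "a \<noteq> xh" using aS out by (auto simp: S_def)
  have Wa: "W *v (a + t *\<^sub>R v) - zh = d + t *\<^sub>R (W *v v)" for t v
    by (simp add: d_def matrix_vector_right_distrib matrix_vector_mult_scaleR)
  have dir: "(xh - a) \<bullet> v \<le> 0" if "t > 0" "norm (d + t *\<^sub>R (W *v v)) \<le> \<rho>" for t v
    using proj[of "a + t *\<^sub>R v", folded a_def] that by (simp add: S_def Wa mult_le_0_iff)
  have nd: "norm d = \<rho>"
  proof (rule ccontr)
    assume "norm d \<noteq> \<rho>"
    with d have lt: "norm d < \<rho>" by simp
    define t where "t = (\<rho> - norm d) / (norm (W *v (xh - a)) + 1)"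
    have t: "t > 0" using lt by (simp add: t_def add_nonneg_pos)
    have "norm (d + t *\<^sub>R (W *v (xh - a))) \<le> norm d + t * norm (W *v (xh - a))"
      using norm_triangle_ineq[of d "t *\<^sub>R (W *v (xh - a))"] t by simp
    also have "\<dots> \<le> norm d + t * (norm (W *v (xh - a)) + 1)"
      using t by simp
    also have "t * (norm (W *v (xh - a)) + 1) = \<rho> - norm d"
      by (simp add: t_def add_nonneg_pos field_simps add_nonneg_eq_0_iff)
    finally have "(xh - a) \<bullet> (xh - a) \<le> 0"
      using t by (intro dir) auto
    then show False
      using neq by (metis inner_gt_zero_iff not_less right_minus_eq)
  qed
  have adj: "(transpose W *v d) \<bullet> v = d \<bullet> (W *v v)" for v
    by (metis dot_lmul_matrix vector_transpose_matrix transpose_transpose)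
  have "transpose W *v d \<noteq> 0"
  proof
    assume "transpose W *v d = 0"
    then have "(W ** transpose W) *v d = 0"
      by (simp add: matrix_vector_mul_assoc[symmetric])
    then have "d = 0"
      using inv by (metis matrix_inv_inverse(2) matrix_vector_mul_assoc matrix_vector_mul_lid matrix_vector_mult_0_right)
    then show False using nd \<open>\<rho> > 0\<close> by simp
  qed
  moreover have "0 \<le> (a - xh) \<bullet> v" if "(transpose W *v d) \<bullet> v < 0" for v
  proof -
    \<comment> \<open>the second point at which the line \<open>W a + t W v\<close> meets the sphere\<close>
    define t where "t = - 2 * (d \<bullet> (W *v v)) / ((W *v v) \<bullet> (W *v v))"
    have neg: "d \<bullet> (W *v v) < 0" using that adj by simp
    then have pos: "(W *v v) \<bullet> (W *v v) > 0" by auto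
    have "t > 0" using neg pos by (simp add: t_def divide_neg_pos)
    have "(norm (d + t *\<^sub>R (W *v v)))\<^sup>2 = (norm d)\<^sup>2 + t * (2 * (d \<bullet> (W *v v)) + t * ((W *v v) \<bullet> (W *v v)))"
      by (simp add: power2_norm_eq_inner inner_add_left inner_add_right inner_commute algebra_simps)
    also have "\<dots> = \<rho>\<^sup>2"
      using pos nd by (simp add: t_def)
    finally have "norm (d + t *\<^sub>R (W *v v)) = \<rho>"
      using \<open>\<rho> > 0\<close> by simp
    then have "(xh - a) \<bullet> v \<le> 0"
      using dir[OF \<open>t > 0\<close>] by simp
    then show ?thesis by (simp add: inner_diff_left)
  qed
  ultimately obtain l where l: "0 \<le> l" "a - xh = - (l *\<^sub>R (transpose W *v d))"
    using antiparallel_if_halfspace by blast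
  have "l \<noteq> 0" using l(2) neq by auto
  then show ?thesis
    using that[of l a] l nd by (simp add: d_def)
qed

section \<open>Estimates in the maximum norm\<close>

lemma infnorm_le_iff: "infnorm v \<le> r \<longleftrightarrow> (\<forall>i. \<bar>v $ i\<bar> \<le> r)" for v :: "real ^ 'k"
  by (auto simp: infnorm_Max Basis_vec_def inner_axis)

lemma mat_infnorm_nonneg: "0 \<le> mat_infnorm (A :: real ^ 'n ^ 'm)"
proof -
  have "0 \<le> (\<Sum>j\<in>UNIV. \<bar>A $ i $ j\<bar>)" for i
    by (simp add: sum_nonneg)
  moreover have "(\<Sum>j\<in>UNIV. \<bar>A $ i $ j\<bar>) \<le> mat_infnorm A" for i
    unfolding mat_infnorm_def by (intro Max_ge) auto
  ultimately show ?thesis by (meson order_trans)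
qed

lemma infnorm_matrix_vector_mult_le:
  fixes A :: "real ^ 'n ^ 'm"
  shows "infnorm (A *v v) \<le> mat_infnorm A * infnorm v"
  unfolding infnorm_le_iff
proof
  fix i
  have "\<bar>(A *v v) $ i\<bar> \<le> (\<Sum>j\<in>UNIV. \<bar>A $ i $ j\<bar> * \<bar>v $ j\<bar>)"
    unfolding matrix_vector_mult_def by (simp add: abs_mult[symmetric] sum_abs)
  also have "\<dots> \<le> (\<Sum>j\<in>UNIV. \<bar>A $ i $ j\<bar> * infnorm v)"
    by (intro sum_mono mult_left_mono component_le_infnorm_cart) auto
  also have "\<dots> = (\<Sum>j\<in>UNIV. \<bar>A $ i $ j\<bar>) * infnorm v"
    by (simp add: sum_distrib_right)
  also have "\<dots> \<le> mat_infnorm A * infnorm v"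
    unfolding mat_infnorm_def by (intro mult_right_mono Max_ge infnorm_pos_le) auto
  finally show "\<bar>(A *v v) $ i\<bar> \<le> mat_infnorm A * infnorm v" .
qed

lemma vec_min_le: "vec_min v \<le> v $ i"
  unfolding vec_min_def by (intro Min_le) auto

text \<open>Applying \<open>W\<close> to the stationarity condition gives \<open>W W\<^sup>T (l d) = (W xh - zh) - d\<close>, which is
  solved for \<open>l d\<close>. Estimating \<open>d\<close> in the maximum norm, instead of its Euclidean norm \<open>\<rho>\<close>, keeps the
  dimension out of the bound.\<close>

lemma multiplier_bound:
  fixes W :: "real ^ 'n ^ 'm" and a xh :: "real ^ 'n" and zh :: "real ^ 'm"
  defines "d \<equiv> W *v a - zh"
  assumes inv: "invertible (W ** transpose W)" and "0 \<le> l"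
    and stat: "a - xh = - (l *\<^sub>R (transpose W *v d))"
  shows "l * infnorm d
    \<le> mat_infnorm (matrix_inv (W ** transpose W)) * (infnorm (W *v xh - zh) + infnorm d)"
proof -
  let ?K = "W ** transpose W"
  have "W *v (a - xh) = - (?K *v (l *\<^sub>R d))"
    unfolding stat by (simp add: matrix_vector_mult_scaleR matrix_vector_mul_assoc[symmetric]
        linear_neg[OF matrix_vector_mul_linear])
  then have "?K *v (l *\<^sub>R d) = (W *v xh - zh) - d"
    by (simp add: d_def matrix_vector_mult_diff_distrib algebra_simps)
  then have "l *\<^sub>R d = matrix_inv ?K *v ((W *v xh - zh) - d)"
    by (metis inv matrix_inv_inverse(2) matrix_vector_mul_assoc matrix_vector_mul_lid)
  then have "infnorm (l *\<^sub>R d) \<le> mat_infnorm (matrix_inv ?K) * infnorm ((W *v xh - zh) - d)"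
    using infnorm_matrix_vector_mult_le by metis
  also have "\<dots> \<le> mat_infnorm (matrix_inv ?K) * (infnorm (W *v xh - zh) + infnorm d)"
    using infnorm_triangle[of "W *v xh - zh" "- d"]
    by (intro mult_left_mono mat_infnorm_nonneg) (simp add: infnorm_neg)
  finally show ?thesis
    using \<open>0 \<le> l\<close> by (simp add: infnorm_mul)
qed

text \<open>After multiplication by \<open>(m - \<delta>)\<^sup>2 / l\<close> the last claim becomes \<open>l \<delta>\<^sup>2 w\<^sup>2 < m\<^sup>2 - \<delta>\<^sup>2\<close>. With
  \<open>k = w\<^sup>2 N\<close>, the bound on \<open>l \<delta>\<close> reduces this to \<open>\<beta> \<delta> k + \<delta>\<^sup>2 (1 + k) < m\<^sup>2\<close>, and the
  assumptions on \<open>\<beta>\<close> and \<open>\<rho>\<close> each bound one summand by half of \<open>m\<^sup>2\<close>.\<close>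

lemma penalty_parameter_bound:
  fixes l \<delta> m w N \<beta> \<rho> :: real
  assumes "0 < l" "0 \<le> \<delta>" "\<delta> \<le> \<rho>" "0 < \<rho>" "0 \<le> N" "0 \<le> \<beta>"
    and lam: "l * \<delta> \<le> N * (\<beta> + \<delta>)"
    and rho: "\<rho> < m / (2 * (1 + w\<^sup>2 * N))"
    and beta: "\<beta> < m\<^sup>2 / (2 * \<rho> * (w\<^sup>2 * N))"
  defines "c \<equiv> l * \<delta> / (m - \<delta>)"
  shows "\<delta> < m" "c\<^sup>2 * w\<^sup>2 < 2 * c + l"
proof -
  define k where "k = w\<^sup>2 * N"
  have "k \<ge> 0" using assms by (simp add: k_def)
  have rk: "\<rho> * (1 + k) < m / 2"
    using rho \<open>k \<ge> 0\<close> unfolding k_def[symmetric] by (simp add: field_simps)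
  then have "\<rho> < m / 2"
    using \<open>k \<ge> 0\<close> \<open>0 < \<rho>\<close> by (smt (verit) mult_le_cancel_left1)
  then show dm: "\<delta> < m" using assms by linarith
  have "m > 0" using dm assms by linarith
  \<comment> \<open>division by zero gives 0, so \<open>k = 0\<close> would make the bound on \<open>\<beta>\<close> unsatisfiable\<close>
  have "k \<noteq> 0"
    using beta \<open>0 \<le> \<beta>\<close> unfolding k_def[symmetric] by auto
  then have "k > 0" using \<open>k \<ge> 0\<close> by simp
  have bk: "\<beta> * \<rho> * k < m\<^sup>2 / 2"
    using beta \<open>k > 0\<close> \<open>0 < \<rho>\<close> unfolding k_def[symmetric] by (simp add: field_simps)
  have "l * \<delta>\<^sup>2 * w\<^sup>2 = (l * \<delta>) * (\<delta> * w\<^sup>2)"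
    by (simp add: power2_eq_square)
  also have "\<dots> \<le> (N * (\<beta> + \<delta>)) * (\<delta> * w\<^sup>2)"
    using lam assms by (intro mult_right_mono) auto
  also have "\<dots> = \<beta> * \<delta> * k + \<delta> * (\<delta> * (1 + k)) - \<delta>\<^sup>2"
    by (simp add: k_def power2_eq_square algebra_simps)
  also have "\<dots> \<le> \<beta> * \<rho> * k + \<rho> * (\<rho> * (1 + k)) - \<delta>\<^sup>2"
    using assms \<open>k > 0\<close>
    by (intro diff_right_mono add_mono mult_mono mult_right_mono mult_left_mono) auto
  also have "\<rho> * (\<rho> * (1 + k)) \<le> m * (m / 2)"
    using rk \<open>\<rho> < m / 2\<close> \<open>0 < \<rho>\<close> \<open>k > 0\<close> by (intro mult_mono) auto
  finally have key: "l * \<delta>\<^sup>2 * w\<^sup>2 < m\<^sup>2 - \<delta>\<^sup>2"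
    using bk by (simp add: power2_eq_square)
  have "c\<^sup>2 * w\<^sup>2 = l * (l * \<delta>\<^sup>2 * w\<^sup>2) / (m - \<delta>)\<^sup>2"
    by (simp add: c_def power_divide power_mult_distrib power2_eq_square)
  also have "\<dots> < l * (m\<^sup>2 - \<delta>\<^sup>2) / (m - \<delta>)\<^sup>2"
    using key \<open>0 < l\<close> dm by (intro divide_strict_right_mono mult_strict_left_mono) auto
  also have "\<dots> = l * (m + \<delta>) / (m - \<delta>)"
    using dm by (simp add: power2_eq_square square_diff_square_factored)
  also have "\<dots> = 2 * c + l"
    using dm by (simp add: c_def field_simps)
  finally show "c\<^sup>2 * w\<^sup>2 < 2 * c + l" .
qed

section \<open>Tightness of the relaxation\<close>

theorem theorem2p2:
  fixes W :: "real ^ 'n ^ 'm" and xh :: "real ^ 'n" and zh :: "real ^ 'm" and \<rho> :: real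
  assumes "\<rho> > 0"
    and "\<rho> \<ge> norm (ReLU (W *v xh) - zh) \<or>
         (invertible (W ** transpose W) \<and>
          \<rho> < vec_min zh / (2 * (1 + kappa W)) \<and>
          infnorm (W *v xh - zh) < (vec_min zh)\<^sup>2 / (2 * \<rho> * kappa W))"
  shows "sdp_tight W xh zh \<rho> \<and>
         L_lb W xh zh \<rho> = L_star W xh zh \<rho> \<and>
         (\<exists>x z. sdp_optimal W xh zh \<rho> (outer (stack x z)) \<and>
                layer_optimal W xh zh \<rho> x \<and>
                norm (x - xh) = L_lb W xh zh \<rho>)"
proof (cases "norm (ReLU (W *v xh) - zh) \<le> \<rho>")
  case True
  then show ?thesis by (rule tight_if_data_feasible)
next
  case False
  let ?N = "mat_infnorm (matrix_inv (W ** transpose W))" and ?w = "onorm ((*v) W)"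
  have inv: "invertible (W ** transpose W)"
    and rho: "\<rho> < vec_min zh / (2 * (1 + ?w\<^sup>2 * ?N))"
    and beta: "infnorm (W *v xh - zh) < (vec_min zh)\<^sup>2 / (2 * \<rho> * (?w\<^sup>2 * ?N))"
    using assms(2) False by (auto simp: kappa_def)
  have "vec_min zh > \<rho>"
  proof -
    have k: "0 \<le> ?w\<^sup>2 * ?N" by (simp add: mat_infnorm_nonneg)
    then have "\<rho> * (2 * (1 + ?w\<^sup>2 * ?N)) < vec_min zh"
      using rho by (simp add: pos_less_divide_eq)
    moreover have "\<rho> * 1 \<le> \<rho> * (2 * (1 + ?w\<^sup>2 * ?N))"
      using k \<open>\<rho> > 0\<close> by (intro mult_left_mono) auto
    ultimately show ?thesis by simp
  qed
  then have active: "0 \<le> v $ i" if "norm (v - zh) \<le> \<rho>" for v :: "real ^ 'm" and i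
    using component_le_norm_cart[of "v - zh" i] that vec_min_le[of zh i] by simp
  have out: "norm (W *v xh - zh) > \<rho>"
  proof (rule ccontr)
    assume in_ball: "\<not> norm (W *v xh - zh) > \<rho>"
    then have "ReLU (W *v xh) = W *v xh"
      using active by (simp add: ReLU_def vec_eq_iff max_absorb1)
    then show False using False in_ball by simp
  qed
  obtain a l where l: "0 < l" and nd: "norm (W *v a - zh) = \<rho>"
    and stat: "a - xh = - (l *\<^sub>R (transpose W *v (W *v a - zh)))"
    using projection_multiplier[OF inv \<open>\<rho> > 0\<close> out] .
  define d where "d = W *v a - zh"
  define \<delta> where "\<delta> = infnorm d"
  \<comment> \<open>the least \<open>c\<close> for which \<open>(W a)\<^sub>i \<ge> vec_min zh - \<delta>\<close> and \<open>d\<^sub>i \<ge> - \<delta>\<close> imply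
    \<open>c (W a)\<^sub>i + l d\<^sub>i \<ge> 0\<close>\<close>
  define c where "c = l * \<delta> / (vec_min zh - \<delta>)"
  have "0 \<le> \<delta>" by (simp add: \<delta>_def infnorm_pos_le)
  have "\<delta> \<le> \<rho>" using infnorm_le_norm[of d] nd by (simp add: \<delta>_def d_def)
  have "l * \<delta> \<le> ?N * (infnorm (W *v xh - zh) + \<delta>)"
    using multiplier_bound[OF inv _ stat] l by (simp add: \<delta>_def d_def)
  note bounds = penalty_parameter_bound[OF l \<open>0 \<le> \<delta>\<close> \<open>\<delta> \<le> \<rho>\<close> \<open>\<rho> > 0\<close>
      mat_infnorm_nonneg infnorm_pos_le this rho beta, folded c_def]
  have c: "0 \<le> c"
    using l \<open>0 \<le> \<delta>\<close> bounds(1) by (simp add: c_def)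
  have "0 \<le> c * (W *v a) $ i + l * d $ i" for i
  proof -
    have di: "\<bar>d $ i\<bar> \<le> \<delta>"
      unfolding \<delta>_def by (rule component_le_infnorm_cart)
    then have "vec_min zh - \<delta> \<le> (W *v a) $ i"
      using vec_min_le[of zh i] by (simp add: d_def)
    then have "c * (vec_min zh - \<delta>) \<le> c * (W *v a) $ i"
      using c by (rule mult_left_mono)
    moreover have "c * (vec_min zh - \<delta>) = l * \<delta>"
      using bounds(1) by (simp add: c_def)
    moreover have "l * (- \<delta>) \<le> l * d $ i"
      using di l by (intro mult_left_mono) auto
    ultimately show ?thesis by simp
  qed
  then show ?thesis
    using l active[of "W *v a"] nd
    by (intro tight_if_dual_certificate[OF stat nd _ _ c _ bounds(2)]) (auto simp: d_def)
qed

end
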